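(* Let $X$ be a topological space. Then the quotient groups $$\frac{\mathcal{F}_b(X,\mathbb{Z})}{\mathcal{H}_b(X)}\quad\text{and}\quad\frac{\mathcal{F}_b(X,\mathbb{Z})}{\mathcal{H}_b(X)\oplus\mathcal{C}_b(X,\mathbb{Z})}$$ are free abelian groups.
   Context: $\mathcal{F}_b(X,\mathbb{Z})$ is the group (under pointwise addition) of all bounded functions $X\to\mathbb{Z}$ (not necessarily continuous). $\mathcal{C}_b(X,\mathbb{Z})$ is its subgroup of bounded continuous functions, where $\mathbb{Z}$ has the discrete topology. A function $f:X\to\mathbb{Z}$ is residual if $f^{-1}(0)$ contains an open dense subset of $X$; $\mathcal{H}_b(X)$ is the subgroup of $\mathcal{F}_b(X,\mathbb{Z})$ consisting of the bounded residual functions. The only residual continuous function is $0$, so $\mathcal{H}_b(X)\cap\mathcal{C}_b(X,\mathbb{Z})=0$ and $\mathcal{H}_b(X)\oplus\mathcal{C}_b(X,\mathbb{Z})$ denotes the internal sum inside $\mathcal{F}_b(X,\mathbb{Z})$. "Free" means free abelian, i.e. having a $\mathbb{Z}$-basis. *)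

theory Defs
  imports "HOL-Analysis.Abstract_Topology" "HOL-Algebra.Free_Abelian_Groups"
begin

text \<open>
  Functions on \<open>topspace X\<close> are extensional: they are \<open>undefined\<close> off \<open>topspace X\<close>, so that
  equality of elements is equality of functions on the space. The operation inherited from
  \<open>product_group\<close> is pointwise addition, written multiplicatively as always in HOL-Algebra.
\<close>

definition bounded_fun_group :: "'a topology \<Rightarrow> ('a \<Rightarrow> int) monoid" where
  "bounded_fun_group X =
     (product_group (topspace X) (\<lambda>_. integer_group))
       \<lparr>carrier := {f \<in> topspace X \<rightarrow>\<^sub>E UNIV. \<exists>M. \<forall>x\<in>topspace X. \<bar>f x\<bar> \<le> M}\<rparr>"

definition bounded_cont_funs :: "'a topology \<Rightarrow> ('a \<Rightarrow> int) set" where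
  "bounded_cont_funs X =
     {f \<in> carrier (bounded_fun_group X). continuous_map X (discrete_topology UNIV) f}"

definition residual_fun :: "'a topology \<Rightarrow> ('a \<Rightarrow> int) \<Rightarrow> bool" where
  "residual_fun X f \<longleftrightarrow>
     (\<exists>U. openin X U \<and> X closure_of U = topspace X \<and> U \<subseteq> {x \<in> topspace X. f x = 0})"

definition bounded_residual_funs :: "'a topology \<Rightarrow> ('a \<Rightarrow> int) set" where
  "bounded_residual_funs X = {f \<in> carrier (bounded_fun_group X). residual_fun X f}"

text \<open>
  A \<open>\<int>\<close>-basis in multiplicative notation: every element is a unique finite product of integer
  powers of elements of \<open>B\<close>, the exponents being given by a finitely supported function.
\<close>

definition Z_basis :: "('a, 'b) monoid_scheme \<Rightarrow> 'a set \<Rightarrow> bool" where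
  "Z_basis G B \<longleftrightarrow> B \<subseteq> carrier G \<and>
     (\<forall>g\<in>carrier G. \<exists>!c :: 'a \<Rightarrow>\<^sub>0 int. Poly_Mapping.keys c \<subseteq> B \<and>
        g = finprod G (\<lambda>b. b [^]\<^bsub>G\<^esub> Poly_Mapping.lookup c b) (Poly_Mapping.keys c))"

definition free_abelian :: "('a, 'b) monoid_scheme \<Rightarrow> bool" where
  "free_abelian G \<longleftrightarrow> comm_group G \<and> (\<exists>B. Z_basis G B)"

lemma carrier_bounded_fun_group:
  "f \<in> carrier (bounded_fun_group X) \<longleftrightarrow>
     f \<in> extensional (topspace X) \<and> (\<exists>M. \<forall>x\<in>topspace X. \<bar>f x\<bar> \<le> M)"
  by (auto simp: bounded_fun_group_def PiE_def)

lemma mult_bounded_fun_group: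
  "f \<otimes>\<^bsub>bounded_fun_group X\<^esub> g = (\<lambda>x\<in>topspace X. f x + g x)"
  by (simp add: bounded_fun_group_def product_group_def)

lemma one_bounded_fun_group: "\<one>\<^bsub>bounded_fun_group X\<^esub> = (\<lambda>x\<in>topspace X. 0)"
  by (simp add: bounded_fun_group_def product_group_def)

lemma comm_group_bounded_fun_group: "comm_group (bounded_fun_group X)"
proof (rule comm_groupI)
  fix f g assume "f \<in> carrier (bounded_fun_group X)" "g \<in> carrier (bounded_fun_group X)"
  then obtain M N where "\<forall>x\<in>topspace X. \<bar>f x\<bar> \<le> M" "\<forall>x\<in>topspace X. \<bar>g x\<bar> \<le> N"
    by (auto simp: carrier_bounded_fun_group)
  then have "\<forall>x\<in>topspace X. \<bar>f x + g x\<bar> \<le> M + N"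
    by (smt (verit))
  then show "f \<otimes>\<^bsub>bounded_fun_group X\<^esub> g \<in> carrier (bounded_fun_group X)"
    by (auto simp: carrier_bounded_fun_group mult_bounded_fun_group)
next
  fix f assume f: "f \<in> carrier (bounded_fun_group X)"
  then have "(\<lambda>x\<in>topspace X. - f x) \<in> carrier (bounded_fun_group X)"
    by (auto simp: carrier_bounded_fun_group)
  then show "\<exists>g\<in>carrier (bounded_fun_group X). g \<otimes>\<^bsub>bounded_fun_group X\<^esub> f = \<one>\<^bsub>bounded_fun_group X\<^esub>"
    by (rule bexI[rotated]) (auto simp: mult_bounded_fun_group one_bounded_fun_group)
qed (auto simp: carrier_bounded_fun_group mult_bounded_fun_group one_bounded_fun_group
       extensional_def restrict_def fun_eq_iff)

lemma inv_bounded_fun_group: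
  assumes "f \<in> carrier (bounded_fun_group X)"
  shows "inv\<^bsub>bounded_fun_group X\<^esub> f = (\<lambda>x\<in>topspace X. - f x)"
proof -
  interpret comm_group "bounded_fun_group X" by (rule comm_group_bounded_fun_group)
  have "(\<lambda>x\<in>topspace X. - f x) \<in> carrier (bounded_fun_group X)"
    using assms by (auto simp: carrier_bounded_fun_group)
  moreover have "(\<lambda>x\<in>topspace X. - f x) \<otimes>\<^bsub>bounded_fun_group X\<^esub> f = \<one>\<^bsub>bounded_fun_group X\<^esub>"
    by (auto simp: mult_bounded_fun_group one_bounded_fun_group)
  ultimately show ?thesis
    using assms inv_equality by blast
qed

lemma subgroup_bounded_cont_funs: "subgroup (bounded_cont_funs X) (bounded_fun_group X)"
proof -
  interpret comm_group "bounded_fun_group X" by (rule comm_group_bounded_fun_group)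
  have cont2: "continuous_map X (discrete_topology UNIV) (\<lambda>x\<in>topspace X. h (f x) (g x))"
    if f: "continuous_map X (discrete_topology UNIV) f"
      and g: "continuous_map X (discrete_topology UNIV) g"
    for f g :: "_ \<Rightarrow> int" and h :: "int \<Rightarrow> int \<Rightarrow> int"
    unfolding continuous_map_def
  proof (intro conjI allI impI)
    fix U
    have "openin X {x \<in> topspace X. f x = a}" "openin X {x \<in> topspace X. g x = a}" for a
      using openin_continuous_map_preimage[OF f, of "{a}"]
            openin_continuous_map_preimage[OF g, of "{a}"] by auto
    then have "openin X (\<Union>(a, b) \<in> {(a, b). h a b \<in> U}.
        {x \<in> topspace X. f x = a} \<inter> {x \<in> topspace X. g x = b})"
      by (intro openin_Union) auto
    moreover have "(\<Union>(a, b) \<in> {(a, b). h a b \<in> U}.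
        {x \<in> topspace X. f x = a} \<inter> {x \<in> topspace X. g x = b})
        = {x \<in> topspace X. (\<lambda>x\<in>topspace X. h (f x) (g x)) x \<in> U}" by auto
    ultimately show "openin X {x \<in> topspace X. (\<lambda>x\<in>topspace X. h (f x) (g x)) x \<in> U}"
      by simp
  qed auto
  show ?thesis
  proof (rule subgroupI)
    have "(\<lambda>x\<in>topspace X. 0) \<in> bounded_cont_funs X"
      using cont2[of "\<lambda>_. 0" "\<lambda>_. 0" "\<lambda>_ _. 0"]
      by (auto simp: bounded_cont_funs_def carrier_bounded_fun_group)
    then show "bounded_cont_funs X \<noteq> {}" by blast
    fix f assume f: "f \<in> bounded_cont_funs X"
    then have "inv\<^bsub>bounded_fun_group X\<^esub> f = (\<lambda>x\<in>topspace X. - f x)"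
      by (simp add: bounded_cont_funs_def inv_bounded_fun_group)
    then show "inv\<^bsub>bounded_fun_group X\<^esub> f \<in> bounded_cont_funs X"
      using f cont2[of f f "\<lambda>a _. - a"]
      by (auto simp: bounded_cont_funs_def carrier_bounded_fun_group)
    fix g assume "g \<in> bounded_cont_funs X"
    with f show "f \<otimes>\<^bsub>bounded_fun_group X\<^esub> g \<in> bounded_cont_funs X"
      using cont2[of f g "(+)"] m_closed[of f g]
      by (auto simp: bounded_cont_funs_def mult_bounded_fun_group)
  qed (auto simp: bounded_cont_funs_def)
qed

lemma dense_openin_Int:
  assumes "openin X U" "X closure_of U = topspace X" "X closure_of V = topspace X"
  shows "X closure_of (U \<inter> V) = topspace X"
proof -
  have "X closure_of (U \<inter> V) = X closure_of (U \<inter> X closure_of V)"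
    using assms(1) closure_of_openin_Int_closure_of by metis
  then show ?thesis
    using assms by (metis inf.absorb1 openin_subset)
qed

lemma subgroup_bounded_residual_funs: "subgroup (bounded_residual_funs X) (bounded_fun_group X)"
proof -
  interpret comm_group "bounded_fun_group X" by (rule comm_group_bounded_fun_group)
  show ?thesis
  proof (rule subgroupI)
    have "(\<lambda>x\<in>topspace X. 0) \<in> bounded_residual_funs X"
      by (auto simp: bounded_residual_funs_def residual_fun_def carrier_bounded_fun_group
          intro!: exI[of _ "topspace X"])
    then show "bounded_residual_funs X \<noteq> {}" by blast
    fix f assume f: "f \<in> bounded_residual_funs X"
    then have "inv\<^bsub>bounded_fun_group X\<^esub> f = (\<lambda>x\<in>topspace X. - f x)"
      by (simp add: bounded_residual_funs_def inv_bounded_fun_group)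
    moreover have "residual_fun X (\<lambda>x\<in>topspace X. - f x)"
      using f unfolding bounded_residual_funs_def residual_fun_def by (auto simp: subset_iff)
    ultimately show "inv\<^bsub>bounded_fun_group X\<^esub> f \<in> bounded_residual_funs X"
      using f by (auto simp: bounded_residual_funs_def carrier_bounded_fun_group)
    fix g assume g: "g \<in> bounded_residual_funs X"
    obtain U V where U: "openin X U" "X closure_of U = topspace X" "U \<subseteq> {x \<in> topspace X. f x = 0}"
      and V: "openin X V" "X closure_of V = topspace X" "V \<subseteq> {x \<in> topspace X. g x = 0}"
      using f g by (auto simp: bounded_residual_funs_def residual_fun_def)
    have "residual_fun X (\<lambda>x\<in>topspace X. f x + g x)"
      unfolding residual_fun_def
      using U V dense_openin_Int[of X U V]
      by (intro exI[of _ "U \<inter> V"]) (auto simp: subset_iff openin_Int)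
    with f g show "f \<otimes>\<^bsub>bounded_fun_group X\<^esub> g \<in> bounded_residual_funs X"
      using m_closed[of f g]
      by (auto simp: bounded_residual_funs_def mult_bounded_fun_group)
  qed (auto simp: bounded_residual_funs_def)
qed

lemma bounded_residual_Int_cont_funs:
  "bounded_residual_funs X \<inter> bounded_cont_funs X = {\<one>\<^bsub>bounded_fun_group X\<^esub>}"
proof
  show "{\<one>\<^bsub>bounded_fun_group X\<^esub>} \<subseteq> bounded_residual_funs X \<inter> bounded_cont_funs X"
    using subgroup.one_closed subgroup_bounded_cont_funs subgroup_bounded_residual_funs by blast
  show "bounded_residual_funs X \<inter> bounded_cont_funs X \<subseteq> {\<one>\<^bsub>bounded_fun_group X\<^esub>}"
  proof
    fix f assume f: "f \<in> bounded_residual_funs X \<inter> bounded_cont_funs X"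
    then obtain U where U: "X closure_of U = topspace X" "U \<subseteq> {x \<in> topspace X. f x = 0}"
      by (auto simp: bounded_residual_funs_def residual_fun_def)
    have "closedin X {x \<in> topspace X. f x \<in> {0}}"
      using f by (intro closedin_continuous_map_preimage[of X "discrete_topology UNIV"])
        (auto simp: bounded_cont_funs_def)
    then have "topspace X \<subseteq> {x \<in> topspace X. f x = 0}"
      using U closure_of_minimal[of U "{x \<in> topspace X. f x = 0}" X] by simp
    then have "f = (\<lambda>x\<in>topspace X. 0)"
      using f by (auto simp: bounded_cont_funs_def carrier_bounded_fun_group extensional_def fun_eq_iff)
    then show "f \<in> {\<one>\<^bsub>bounded_fun_group X\<^esub>}" by (simp add: one_bounded_fun_group)
  qed
qed

end

theory Submission
  imports Defs "HOL-Library.Function_Algebras"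
begin

text \<open>
  Bounded integer-valued functions are the \<open>\<int>\<close>-combinations of indicators of sets, the bounded
  continuous ones are the combinations of indicators of clopen sets, and the residual functions
  are those that vanish outside a nowhere dense set. Both quotients are therefore instances of a
  statement on Boolean algebras of sets in the spirit of Noebeling and Bergman: for algebras
  \<open>\<C> \<subseteq> \<A>\<close> of subsets and an ideal \<open>\<I>\<close> of sets, the group \<open>S(\<A>)\<close> of simple functions over \<open>\<A>\<close> is free
  modulo the functions \<open>N(\<I>)\<close> supported in \<open>\<I>\<close>, and also modulo \<open>S(\<C>) + N(\<I>)\<close>.

  The reason is an induction on the number of generating sets, taken as an ordinal. Adjoin the sets
  of \<open>\<A>\<close> one at a time along a well-order. If \<open>\<B>\<close> is the algebra reached so far and \<open>E\<close> the next
  set, every simple function over the enlarged algebra is \<open>g + h * ind E\<close> with \<open>g\<close>, \<open>h\<close> simple over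
  \<open>\<B>\<close>. Multiplication by \<open>ind E\<close> thus identifies the quotient of the new stage by the old one,
  both taken modulo \<open>N(\<I>)\<close>, with \<open>S(\<B>)\<close> modulo \<open>N(\<J>)\<close> for a new ideal \<open>\<J>\<close> (\<open>basis_mod_adjoin_set\<close>). As \<open>\<B>\<close> is generated by fewer
  sets than the final algebra, the induction hypothesis, stated for all ideals at once, makes this
  quotient free. A chain with free successive quotients has a free union (\<open>basis_mod_chain\<close>), whence
  \<open>basis_mod_generate\<close>. With the trivial algebra \<open>{{}, UNIV}\<close> at the bottom, this gives the absolute
  result \<open>basis_mod_null_funs\<close>; once that is known for every algebra, the same chain started
  at \<open>\<C>\<close> gives the relative result \<open>basis_mod_subalgebra\<close>.
\<close>

section \<open>Bases relative to a submodule\<close>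

locale relative_module = module scale
  for scale :: "'r::comm_ring_1 \<Rightarrow> 'b::ab_group_add \<Rightarrow> 'b"
begin

text \<open>
  \<open>basis_mod H T B\<close> says that the classes of the elements of \<open>B\<close> form a basis of
  \<open>(span T + span H) / span H\<close>. Speaking of representatives instead of cosets lets submodules \<open>H\<close> and
  generating sets \<open>T\<close> vary inside one ambient type, which the transfinite arguments below depend on.
\<close>

definition basis_mod :: "'b set \<Rightarrow> 'b set \<Rightarrow> 'b set \<Rightarrow> bool" where
  "basis_mod H T B \<longleftrightarrow> B \<subseteq> T \<and> T \<subseteq> span (H \<union> B) \<and>
     (\<forall>F c. finite F \<longrightarrow> F \<subseteq> B \<longrightarrow> (\<Sum>b\<in>F. scale (c b) b) \<in> span H \<longrightarrow> (\<forall>b\<in>F. c b = 0))"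

lemma basis_modD:
  assumes "basis_mod H T B"
  shows "B \<subseteq> T" "T \<subseteq> span (H \<union> B)"
    "\<And>F c b. finite F \<Longrightarrow> F \<subseteq> B \<Longrightarrow> (\<Sum>b\<in>F. scale (c b) b) \<in> span H \<Longrightarrow> b \<in> F \<Longrightarrow> c b = 0"
  using assms unfolding basis_mod_def by blast+

text \<open>
  A well-ordered chain of submodules with free successive quotients has a free union: with \<open>P i\<close>
  generating the stage strictly below \<open>i\<close> and \<open>Q i\<close> the stage reached at \<open>i\<close>, bases of the
  successive quotients combine to a basis over the bottom. In a nontrivial relation look at the
  largest index that occurs: modulo \<open>P i\<close> only that block survives, and it is independent there.
  Generation is a well-founded induction, in which covering \<open>P i\<close> by all earlier \<open>Q j\<close> handles
  successor and limit stages alike.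
\<close>

lemma basis_mod_chain:
  fixes lt :: "'i \<Rightarrow> 'i \<Rightarrow> bool"
  assumes wf: "wfp lt" and trans: "transp lt" and total: "totalp lt"
    and basis: "\<And>i. i \<in> D \<Longrightarrow> basis_mod (P i) (Q i) (B i)"
    and H_le: "\<And>i. i \<in> D \<Longrightarrow> H \<subseteq> span (P i)"
    and Q_le: "\<And>i j. i \<in> D \<Longrightarrow> j \<in> D \<Longrightarrow> lt j i \<Longrightarrow> Q j \<subseteq> span (P i)"
    and P_le: "\<And>i. i \<in> D \<Longrightarrow> P i \<subseteq> span (H \<union> (\<Union>j\<in>{j\<in>D. lt j i}. Q j))"
    and T_le: "T \<subseteq> span (H \<union> (\<Union>i\<in>D. Q i))"
    and Q_T: "\<And>i. i \<in> D \<Longrightarrow> Q i \<subseteq> T"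
  shows "basis_mod H T (\<Union>i\<in>D. B i)"
proof -
  let ?B = "\<Union>i\<in>D. B i"
  have Q_span: "i \<in> D \<Longrightarrow> Q i \<subseteq> span (H \<union> ?B)" for i
  proof (induction i rule: wfp_induct_rule[OF wf])
    case (1 i)
    have "P i \<subseteq> span (H \<union> ?B)"
    proof -
      have "H \<union> (\<Union>j\<in>{j\<in>D. lt j i}. Q j) \<subseteq> span (H \<union> ?B)"
        using 1 span_superset[of "H \<union> ?B"] by blast
      then show ?thesis
        using P_le[OF 1(2)] span_minimal[OF _ subspace_span] by blast
    qed
    then have "span (P i \<union> B i) \<subseteq> span (H \<union> ?B)"
      using 1(2) span_superset[of "H \<union> ?B"] by (intro span_minimal) auto
    then show ?case
      using basis_modD(2)[OF basis[OF 1(2)]] by blast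
  qed
  have span: "T \<subseteq> span (H \<union> ?B)"
  proof -
    have "H \<union> (\<Union>i\<in>D. Q i) \<subseteq> span (H \<union> ?B)"
      using Q_span span_superset[of "H \<union> ?B"] by blast
    then show ?thesis
      using T_le span_minimal[OF _ subspace_span] by blast
  qed
  have indep: "\<forall>b\<in>F. c b = 0"
    if F: "finite F" "F \<subseteq> ?B" and S: "(\<Sum>b\<in>F. scale (c b) b) \<in> span H" for F c
  proof (rule ccontr)
    let ?N = "{b\<in>F. c b \<noteq> 0}"
    assume "\<not> (\<forall>b\<in>F. c b = 0)"
    then have ne: "?N \<noteq> {}" by auto
    have "\<forall>b\<in>?N. \<exists>i. i \<in> D \<and> b \<in> B i" using F by blast
    then obtain ix where ix: "\<And>b. b \<in> ?N \<Longrightarrow> ix b \<in> D \<and> b \<in> B (ix b)"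
      using bchoice[of ?N "\<lambda>b i. i \<in> D \<and> b \<in> B i"] by blast
    have "asymp lt" using wf by (rule wfp_imp_asymp)
    then have "\<exists>m \<in> ix ` ?N. \<forall>x \<in> ix ` ?N. x \<noteq> m \<longrightarrow> \<not> lt m x"
      using F(1) ne trans
      by (intro Finite_Set.bex_max_element) (auto intro: asymp_on_subset transp_on_subset)
    then obtain m where m: "m \<in> ix ` ?N" and max: "\<And>x. x \<in> ix ` ?N \<Longrightarrow> x = m \<or> lt x m"
      using total unfolding totalp_on_def by blast
    have mD: "m \<in> D" using m ix by blast
    let ?M = "{b\<in>?N. ix b = m}"
    have "scale (c b) b \<in> span (P m)" if "b \<in> ?N - ?M" for b
    proof -
      have "lt (ix b) m" "ix b \<in> D" "b \<in> B (ix b)" using that max ix by auto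
      then have "b \<in> span (P m)"
        using basis_modD(1)[OF basis] Q_le[OF mD] by blast
      then show ?thesis by (rule span_scale)
    qed
    then have lower: "(\<Sum>b\<in>?N - ?M. scale (c b) b) \<in> span (P m)" by (rule span_sum)
    have "(\<Sum>b\<in>F. scale (c b) b) = (\<Sum>b\<in>?N. scale (c b) b)"
      using F(1) by (intro sum.mono_neutral_right) auto
    also have "\<dots> = (\<Sum>b\<in>?N - ?M. scale (c b) b) + (\<Sum>b\<in>?M. scale (c b) b)"
      using F(1) by (intro sum.subset_diff) auto
    finally have "(\<Sum>b\<in>?M. scale (c b) b) = (\<Sum>b\<in>F. scale (c b) b) - (\<Sum>b\<in>?N - ?M. scale (c b) b)"
      by simp
    moreover have "(\<Sum>b\<in>F. scale (c b) b) \<in> span (P m)"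
      using S span_minimal[OF H_le[OF mD] subspace_span] by blast
    ultimately have "(\<Sum>b\<in>?M. scale (c b) b) \<in> span (P m)"
      using span_diff[OF _ lower] by simp
    moreover have "finite ?M" "?M \<subseteq> B m" using F(1) ix by auto
    ultimately have "\<forall>b\<in>?M. c b = 0"
      using basis_modD(3)[OF basis[OF mD]] by blast
    then show False using m by auto
  qed
  show ?thesis
    unfolding basis_mod_def
    using basis_modD(1)[OF basis] Q_T span indep by blast
qed

text \<open>
  The chain with two steps, from \<open>H\<close> through \<open>K\<close> to \<open>T\<close>.
\<close>

lemma basis_mod_trans:
  assumes B1: "basis_mod H K B1" and B2: "basis_mod (K \<union> H) T B2" and "K \<subseteq> T"
  shows "basis_mod H T (B1 \<union> B2)"
proof -
  define P where "P i = (if i = 0 then H else K \<union> H)" for i :: nat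
  define Q where "Q i = (if i = 0 then K else T)" for i :: nat
  define B where "B i = (if i = 0 then B1 else B2)" for i :: nat
  have "basis_mod H T (\<Union>i\<in>{0, 1}. B i)"
  proof (rule basis_mod_chain[where lt = "(<)" and P = P and Q = Q])
    show "Q j \<subseteq> span (P i)" if "i \<in> {0, 1}" "j \<in> {0, 1}" "j < i" for i j
      using that span_superset[of "K \<union> H"] by (auto simp: P_def Q_def)
    show "P i \<subseteq> span (H \<union> (\<Union>j\<in>{j\<in>{0, 1}. j < i}. Q j))" if "i \<in> {0, 1}" for i
      using that by (auto simp: P_def Q_def intro: span_base)
    show "T \<subseteq> span (H \<union> (\<Union>i\<in>{0, 1}. Q i))"
      by (auto simp: Q_def intro: span_base)
  qed (use assms in \<open>auto simp: P_def Q_def B_def intro: span_base\<close>)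
  then show ?thesis by (simp add: B_def Un_commute)
qed

end

section \<open>Free abelian groups from relative bases\<close>

text \<open>
  The bridge from additive notation to groups with carriers: if \<open>\<phi>\<close> maps \<open>T\<close> homomorphically onto
  \<open>Q\<close> with kernel given by \<open>span H\<close>, then the \<open>\<phi>\<close>-image of a basis of \<open>T\<close> modulo \<open>H\<close> is a basis of
  \<open>Q\<close>. The map \<open>\<phi>\<close> is injective on the basis, so coefficient functions can be moved back and forth.
\<close>

lemma free_abelian_of_basis_mod:
  fixes Q :: "('c, 'd) monoid_scheme" and scale :: "int \<Rightarrow> 'b::ab_group_add \<Rightarrow> 'b"
  assumes module: "relative_module scale" and Q: "comm_group Q"
    and T: "module.subspace scale T" and onto: "\<phi> ` T = carrier Q"
    and add: "\<And>f g. f \<in> T \<Longrightarrow> g \<in> T \<Longrightarrow> \<phi> (f + g) = \<phi> f \<otimes>\<^bsub>Q\<^esub> \<phi> g"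
    and kernel: "\<And>f. f \<in> T \<Longrightarrow> \<phi> f = \<one>\<^bsub>Q\<^esub> \<longleftrightarrow> f \<in> module.span scale H"
    and basis: "relative_module.basis_mod scale H T B"
  shows "free_abelian Q"
proof -
  interpret M: relative_module scale by (rule module)
  interpret Q: comm_group Q by (rule Q)
  note B = M.basis_modD[OF basis]
  note T_add = M.subspace_add[OF T] and T_scale = M.subspace_scale[OF T]
    and T_sum = M.subspace_sum[OF T] and T_diff = M.subspace_diff[OF T] and T0 = M.subspace_0[OF T]
  have phi_in: "f \<in> T \<Longrightarrow> \<phi> f \<in> carrier Q" for f using onto by blast
  have phi_0: "\<phi> 0 = \<one>\<^bsub>Q\<^esub>" using kernel[OF T0] M.span_zero by blast
  have phi_diff: "\<phi> (f - g) \<otimes>\<^bsub>Q\<^esub> \<phi> g = \<phi> f" if "f \<in> T" "g \<in> T" for f g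
    using add[OF T_diff[OF that] that(2)] by simp
  have phi_minus: "\<phi> (- f) = inv\<^bsub>Q\<^esub> \<phi> f" if "f \<in> T" for f
    using phi_diff[OF T0 that] phi_0 phi_in[OF that] phi_in[OF T_diff[OF T0 that]]
    by (simp add: Q.inv_equality)
  have phi_nat: "\<phi> (scale (int n) f) = \<phi> f [^]\<^bsub>Q\<^esub> n" if "f \<in> T" for f n
  proof (induction n)
    case (Suc n)
    have "\<phi> (scale (int (Suc n)) f) = \<phi> (scale (int n) f + f)"
      by (simp add: M.scale_left_distrib add.commute)
    then show ?case using Suc that by (simp add: add T_scale)
  qed (simp add: phi_0)
  have phi_scale: "\<phi> (scale k f) = \<phi> f [^]\<^bsub>Q\<^esub> k" if "f \<in> T" for f k
  proof (cases k)
    case (nonneg n)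
    then show ?thesis using phi_nat[OF that] by (simp add: int_pow_int)
  next
    case (neg n)
    have "\<phi> (scale k f) = \<phi> (- scale (int (Suc n)) f)"
      using neg by (simp only: M.scale_minus_left)
    also have "\<dots> = inv\<^bsub>Q\<^esub> (\<phi> f [^]\<^bsub>Q\<^esub> Suc n)"
      using that by (simp only: phi_minus T_scale phi_nat)
    also have "\<dots> = \<phi> f [^]\<^bsub>Q\<^esub> k"
      using neg phi_in[OF that] by (metis Q.int_pow_neg_int)
    finally show ?thesis .
  qed
  have phi_sum: "\<phi> (\<Sum>b\<in>F. scale (c b) b) = finprod Q (\<lambda>b. \<phi> b [^]\<^bsub>Q\<^esub> c b) F"
    if "finite F" "F \<subseteq> T" for F and c :: "'b \<Rightarrow> int"
    using that
  proof (induction F)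
    case (insert b F)
    then have "(\<Sum>b\<in>F. scale (c b) b) \<in> T" by (intro T_sum T_scale) auto
    moreover have "(\<lambda>b. \<phi> b [^]\<^bsub>Q\<^esub> c b) \<in> F \<rightarrow> carrier Q" using insert phi_in by auto
    ultimately show ?case using insert by (simp add: add T_scale phi_scale phi_in)
  qed (simp add: phi_0)
  have phi_eq: "\<phi> f = \<phi> g \<longleftrightarrow> f - g \<in> M.span H" if "f \<in> T" "g \<in> T" for f g
  proof -
    have "\<phi> f = \<phi> g \<longleftrightarrow> \<phi> (f - g) = \<one>\<^bsub>Q\<^esub>"
      using Q.r_cancel_one'[of "\<phi> g" "\<phi> (f - g)"] phi_diff[OF that] phi_in that T_diff
      by auto
    then show ?thesis using kernel T_diff that by simp
  qed
  have inj: "inj_on \<phi> B"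
  proof (rule inj_onI, rule ccontr)
    fix a b assume ab: "a \<in> B" "b \<in> B" "\<phi> a = \<phi> b" "a \<noteq> b"
    define c where "c x = (if x = a then 1 else - 1 :: int)" for x
    have "(\<Sum>x\<in>{a, b}. scale (c x) x) = a - b" using ab by (simp add: c_def)
    also have "\<dots> \<in> M.span H" using phi_eq ab B(1) by blast
    finally have "c a = 0" using B(3)[of "{a, b}" c a] ab by simp
    then show False by (simp add: c_def)
  qed
  define E where "E = \<phi> ` B"
  have E_in: "E \<subseteq> carrier Q" using B(1) phi_in by (auto simp: E_def)
  have "\<exists>!c :: 'c \<Rightarrow>\<^sub>0 int. Poly_Mapping.keys c \<subseteq> E \<and>
          q = finprod Q (\<lambda>b. b [^]\<^bsub>Q\<^esub> Poly_Mapping.lookup c b) (Poly_Mapping.keys c)"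
    if q: "q \<in> carrier Q" for q
  proof (rule ex_ex1I)
    obtain f where f: "f \<in> T" "q = \<phi> f" using q onto by blast
    then have "f \<in> M.span (H \<union> B)" using B(2) by blast
    then obtain h g where h: "h \<in> M.span H" and g: "g \<in> M.span B" and fhg: "f = h + g"
      by (auto simp: M.span_Un)
    from g obtain F c where F: "finite F" "F \<subseteq> B" and gF: "g = (\<Sum>b\<in>F. scale (c b) b)"
      by (auto simp: M.span_explicit)
    have gT: "g \<in> T" unfolding gF using F B(1) by (intro T_sum T_scale) auto
    have "q = \<phi> g" using f gT h fhg phi_eq by simp
    also have "\<dots> = finprod Q (\<lambda>b. \<phi> b [^]\<^bsub>Q\<^esub> c b) F"
      unfolding gF using F B(1) by (intro phi_sum) auto
    finally have q_eq: "q = finprod Q (\<lambda>b. \<phi> b [^]\<^bsub>Q\<^esub> c b) F" .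
    define d where "d x = (if x \<in> \<phi> ` F then c (the_inv_into B \<phi> x) else 0)" for x
    have "finite {x. d x \<noteq> 0}"
      by (rule finite_subset[of _ "\<phi> ` F"]) (use F in \<open>auto simp: d_def split: if_splits\<close>)
    then have look: "Poly_Mapping.lookup (Abs_poly_mapping d) = d"
      by (simp add: Abs_poly_mapping_inverse)
    have keys: "Poly_Mapping.keys (Abs_poly_mapping d) \<subseteq> \<phi> ` F"
      by (auto simp: in_keys_iff look d_def split: if_splits)
    have "q = finprod Q (\<lambda>b. \<phi> b [^]\<^bsub>Q\<^esub> d (\<phi> b)) F"
      unfolding q_eq using F B(1) phi_in
      by (intro Q.finprod_cong') (auto simp: d_def the_inv_into_f_f[OF inj] subset_iff)
    also have "\<dots> = finprod Q (\<lambda>x. x [^]\<^bsub>Q\<^esub> d x) (\<phi> ` F)"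
      using F B(1) phi_in inj by (intro Q.finprod_reindex[symmetric]) (auto intro: inj_on_subset)
    also have "\<dots> = finprod Q (\<lambda>x. x [^]\<^bsub>Q\<^esub> d x) (Poly_Mapping.keys (Abs_poly_mapping d))"
      using F B(1) phi_in keys
      by (intro Q.finprod_mono_neutral_cong_right) (auto simp: in_keys_iff look)
    finally show "\<exists>c :: 'c \<Rightarrow>\<^sub>0 int. Poly_Mapping.keys c \<subseteq> E \<and>
        q = finprod Q (\<lambda>b. b [^]\<^bsub>Q\<^esub> Poly_Mapping.lookup c b) (Poly_Mapping.keys c)"
      using keys F look by (intro exI[of _ "Abs_poly_mapping d"]) (auto simp: E_def)
  next
    fix c d :: "'c \<Rightarrow>\<^sub>0 int"
    assume c: "Poly_Mapping.keys c \<subseteq> E \<and>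
          q = finprod Q (\<lambda>b. b [^]\<^bsub>Q\<^esub> Poly_Mapping.lookup c b) (Poly_Mapping.keys c)"
      and d: "Poly_Mapping.keys d \<subseteq> E \<and>
          q = finprod Q (\<lambda>b. b [^]\<^bsub>Q\<^esub> Poly_Mapping.lookup d b) (Poly_Mapping.keys d)"
    define K where "K = Poly_Mapping.keys c \<union> Poly_Mapping.keys d"
    have "finite K" "K \<subseteq> \<phi> ` B" using c d by (auto simp: K_def E_def)
    then have "K \<subseteq> carrier Q" using E_in by (auto simp: E_def)
    obtain F where F: "F \<subseteq> B" "finite F" "K = \<phi> ` F"
      using finite_subset_image[OF \<open>finite K\<close> \<open>K \<subseteq> \<phi> ` B\<close>] by blast
    define v where "v e = (\<Sum>b\<in>F. scale (Poly_Mapping.lookup e (\<phi> b)) b)" for e :: "'c \<Rightarrow>\<^sub>0 int"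
    have vT: "v e \<in> T" for e unfolding v_def using F B(1) by (intro T_sum T_scale) auto
    have "\<phi> (v e) = q" if e: "Poly_Mapping.keys e \<subseteq> K"
      "q = finprod Q (\<lambda>b. b [^]\<^bsub>Q\<^esub> Poly_Mapping.lookup e b) (Poly_Mapping.keys e)" for e
    proof -
      have "\<phi> (v e) = finprod Q (\<lambda>b. \<phi> b [^]\<^bsub>Q\<^esub> Poly_Mapping.lookup e (\<phi> b)) F"
        unfolding v_def using F B(1) by (intro phi_sum) auto
      also have "\<dots> = finprod Q (\<lambda>x. x [^]\<^bsub>Q\<^esub> Poly_Mapping.lookup e x) K"
        unfolding F(3) using F B(1) phi_in inj
        by (intro Q.finprod_reindex[symmetric]) (auto intro: inj_on_subset)
      also have "\<dots> = q"
        unfolding e(2) using e(1) \<open>finite K\<close> \<open>K \<subseteq> carrier Q\<close>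
        by (intro Q.finprod_mono_neutral_cong_right) (auto simp: in_keys_iff)
      finally show ?thesis .
    qed
    then have "\<phi> (v c) = \<phi> (v d)" using c d by (simp add: K_def)
    then have "v c - v d \<in> M.span H" using phi_eq vT by blast
    also have "v c - v d = (\<Sum>b\<in>F. scale (Poly_Mapping.lookup c (\<phi> b) - Poly_Mapping.lookup d (\<phi> b)) b)"
      by (simp add: v_def sum_subtractf M.scale_left_diff_distrib)
    finally have eq: "\<forall>b\<in>F. Poly_Mapping.lookup c (\<phi> b) = Poly_Mapping.lookup d (\<phi> b)"
      using B(3)[OF F(2,1), of "\<lambda>b. Poly_Mapping.lookup c (\<phi> b) - Poly_Mapping.lookup d (\<phi> b)"]
      by fastforce
    show "c = d"
    proof (rule poly_mapping_eqI)
      fix x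
      show "Poly_Mapping.lookup c x = Poly_Mapping.lookup d x"
      proof (cases "x \<in> K")
        case True
        then show ?thesis using eq F(3) by auto
      next
        case False
        then show ?thesis by (auto simp: K_def in_keys_iff)
      qed
    qed
  qed
  then have "Z_basis Q E" using E_in by (simp add: Z_basis_def)
  then show ?thesis using Q by (auto simp: free_abelian_def)
qed

section \<open>Simple functions, algebras and ideals of sets\<close>

definition scale_fun :: "int \<Rightarrow> ('a \<Rightarrow> int) \<Rightarrow> 'a \<Rightarrow> int" where
  "scale_fun n f = (\<lambda>x. n * f x)"

lemma scale_fun_apply [simp]: "scale_fun n f x = n * f x"
  by (simp add: scale_fun_def)

interpretation fm: relative_module scale_fun
  by unfold_locales (auto simp: fun_eq_iff algebra_simps)

definition ind :: "'a set \<Rightarrow> 'a \<Rightarrow> int" where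
  "ind M = (\<lambda>x. of_bool (x \<in> M))"

lemma ind_apply [simp]: "ind M x = of_bool (x \<in> M)"
  by (simp add: ind_def)

definition set_algebra :: "'a set set \<Rightarrow> bool" where
  "set_algebra \<A> \<longleftrightarrow> UNIV \<in> \<A> \<and> (\<forall>M\<in>\<A>. - M \<in> \<A>) \<and> (\<forall>M\<in>\<A>. \<forall>N\<in>\<A>. M \<inter> N \<in> \<A>)"

lemma set_algebraD:
  assumes "set_algebra \<A>"
  shows "UNIV \<in> \<A>" "{} \<in> \<A>" "M \<in> \<A> \<Longrightarrow> - M \<in> \<A>"
    "M \<in> \<A> \<Longrightarrow> N \<in> \<A> \<Longrightarrow> M \<inter> N \<in> \<A>" "M \<in> \<A> \<Longrightarrow> N \<in> \<A> \<Longrightarrow> M \<union> N \<in> \<A>"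
proof -
  show 1: "UNIV \<in> \<A>" "M \<in> \<A> \<Longrightarrow> - M \<in> \<A>" "M \<in> \<A> \<Longrightarrow> N \<in> \<A> \<Longrightarrow> M \<inter> N \<in> \<A>" for M N
    using assms by (auto simp: set_algebra_def)
  show "{} \<in> \<A>" using 1(2)[OF 1(1)] by simp
  show "M \<union> N \<in> \<A>" if "M \<in> \<A>" "N \<in> \<A>"
    using 1(2)[OF 1(3)[OF 1(2)[OF that(1)] 1(2)[OF that(2)]]] by simp
qed

definition set_ideal :: "'a set set \<Rightarrow> bool" where
  "set_ideal \<I> \<longleftrightarrow> {} \<in> \<I> \<and> (\<forall>M\<in>\<I>. \<forall>N\<in>\<I>. M \<union> N \<in> \<I>) \<and> (\<forall>M\<in>\<I>. \<forall>N. N \<subseteq> M \<longrightarrow> N \<in> \<I>)"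

lemma set_idealD:
  assumes "set_ideal \<I>"
  shows "{} \<in> \<I>" "M \<in> \<I> \<Longrightarrow> N \<in> \<I> \<Longrightarrow> M \<union> N \<in> \<I>" "M \<in> \<I> \<Longrightarrow> N \<subseteq> M \<Longrightarrow> N \<in> \<I>"
  using assms by (auto simp: set_ideal_def)

text \<open>
  Functions that vanish outside a member of the ideal, regardless of boundedness. For simple
  functions over an algebra, quotients by such submodules are the only absolute quotients that
  the induction meets, and they are automatically torsion-free.
\<close>

definition null_funs :: "'a set set \<Rightarrow> ('a \<Rightarrow> int) set" where
  "null_funs \<I> = {f. {x. f x \<noteq> 0} \<in> \<I>}"

lemma subspace_null_funs:
  assumes "set_ideal \<I>"
  shows "fm.subspace (null_funs \<I>)"
proof (rule fm.subspaceI)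
  show "0 \<in> null_funs \<I>" using set_idealD(1)[OF assms] by (simp add: null_funs_def)
  show "f + g \<in> null_funs \<I>" if "f \<in> null_funs \<I>" "g \<in> null_funs \<I>" for f g
    using that unfolding null_funs_def mem_Collect_eq
    by (rule set_idealD(3)[OF assms set_idealD(2)[OF assms]]) auto
  show "scale_fun c f \<in> null_funs \<I>" if "f \<in> null_funs \<I>" for c f
    using that unfolding null_funs_def mem_Collect_eq
    by (rule set_idealD(3)[OF assms]) auto
qed

lemma span_null_funs: "set_ideal \<I> \<Longrightarrow> fm.span (null_funs \<I>) = null_funs \<I>"
  using subspace_null_funs fm.span_eq_iff by blast

definition simple_funs :: "'a set set \<Rightarrow> ('a \<Rightarrow> int) set" where
  "simple_funs \<A> = fm.span (ind ` \<A>)"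

lemma subspace_simple_funs: "fm.subspace (simple_funs \<A>)"
  by (simp add: simple_funs_def)

lemma span_simple_funs: "fm.span (simple_funs \<A>) = simple_funs \<A>"
  by (simp add: simple_funs_def fm.span_span)

lemma simple_funs_mono: "\<A> \<subseteq> \<B> \<Longrightarrow> simple_funs \<A> \<subseteq> simple_funs \<B>"
  unfolding simple_funs_def by (intro fm.span_mono image_mono)

lemma ind_simple_funs: "M \<in> \<A> \<Longrightarrow> ind M \<in> simple_funs \<A>"
  by (auto simp: simple_funs_def intro: fm.span_base)

text \<open>
  The span description is convenient for generation arguments, the description by level sets for
  everything that depends on where a function takes which value.
\<close>

lemma simple_funs_iff:
  assumes "set_algebra \<A>"
  shows "f \<in> simple_funs \<A> \<longleftrightarrow> finite (range f) \<and> (\<forall>k. f -` {k} \<in> \<A>)"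
proof
  assume "f \<in> simple_funs \<A>"
  then have "f \<in> fm.span (ind ` \<A>)" by (simp add: simple_funs_def)
  then show "finite (range f) \<and> (\<forall>k. f -` {k} \<in> \<A>)"
  proof (induction rule: fm.span_induct_alt)
    case base
    have "(0 :: 'a \<Rightarrow> int) -` {k} = (if k = 0 then UNIV else {})" for k
      by auto
    moreover have "range (0 :: 'a \<Rightarrow> int) = {0}" by auto
    ultimately show ?case using set_algebraD[OF assms] by simp
  next
    case (step c h g)
    then obtain M where M: "M \<in> \<A>" "h = ind M" by auto
    define u where "u = scale_fun c h + g"
    have u: "u x = c * of_bool (x \<in> M) + g x" for x by (simp add: u_def M)
    have "range u \<subseteq> range g \<union> (\<lambda>y. c + y) ` range g"
      by (auto simp: u)
    then have "finite (range u)" using step finite_subset by blast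
    moreover have "u -` {k} \<in> \<A>" for k
    proof -
      have "u -` {k} = (M \<inter> g -` {k - c}) \<union> (- M \<inter> g -` {k})"
        by (auto simp: u)
      then show ?thesis using step M set_algebraD[OF assms] by auto
    qed
    ultimately show ?case unfolding u_def by blast
  qed
next
  assume f: "finite (range f) \<and> (\<forall>k. f -` {k} \<in> \<A>)"
  have sum_apply: "(\<Sum>k\<in>K. scale_fun k (ind (f -` {k}))) x = (\<Sum>k\<in>K. k * of_bool (f x = k))"
    if "finite K" for K x
    using that by (induction K) auto
  have "f = (\<Sum>k\<in>range f. scale_fun k (ind (f -` {k})))"
    using f by (auto simp: fun_eq_iff sum_apply of_bool_def if_distrib sum.delta' cong: if_cong)
  moreover have "\<dots> \<in> simple_funs \<A>"
    using f by (intro fm.subspace_sum fm.subspace_scale subspace_simple_funs ind_simple_funs) auto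
  ultimately show "f \<in> simple_funs \<A>" by simp
qed

lemma simple_funs_support:
  assumes "set_algebra \<A>" "f \<in> simple_funs \<A>"
  shows "{x. f x \<noteq> 0} \<in> \<A>"
proof -
  have "{x. f x \<noteq> 0} = - (f -` {0})" by auto
  then show ?thesis using assms simple_funs_iff set_algebraD(3) by metis
qed

lemma simple_funs_times_ind:
  assumes "set_algebra \<A>" "f \<in> simple_funs \<A>" "M \<in> \<A>"
  shows "f * ind M \<in> simple_funs \<A>"
proof -
  have "range (f * ind M) \<subseteq> insert 0 (range f)" by auto
  moreover have "finite (range f)" using assms simple_funs_iff by blast
  ultimately have "finite (range (f * ind M))" using finite_subset by blast
  moreover have "(f * ind M) -` {k} \<in> \<A>" for k
  proof -
    have "(f * ind M) -` {k} = (M \<inter> f -` {k}) \<union> (if k = 0 then - M else {})"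
      by auto
    moreover have "f -` {k} \<in> \<A>" using assms simple_funs_iff by blast
    ultimately show ?thesis using assms(3) set_algebraD[OF assms(1)] by auto
  qed
  ultimately show ?thesis using simple_funs_iff[OF assms(1)] by blast
qed

inductive_set gen_algebra :: "'a set set \<Rightarrow> 'a set set" for \<G> where
  gen_base: "M \<in> \<G> \<Longrightarrow> M \<in> gen_algebra \<G>"
| gen_UNIV: "UNIV \<in> gen_algebra \<G>"
| gen_Compl: "M \<in> gen_algebra \<G> \<Longrightarrow> - M \<in> gen_algebra \<G>"
| gen_Int: "M \<in> gen_algebra \<G> \<Longrightarrow> N \<in> gen_algebra \<G> \<Longrightarrow> M \<inter> N \<in> gen_algebra \<G>"

lemma set_algebra_gen_algebra: "set_algebra (gen_algebra \<G>)"
  by (simp add: set_algebra_def gen_algebra.intros)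

lemma gen_algebra_minimal:
  assumes "set_algebra \<A>" "\<G> \<subseteq> \<A>"
  shows "gen_algebra \<G> \<subseteq> \<A>"
proof
  fix M assume "M \<in> gen_algebra \<G>"
  then show "M \<in> \<A>"
    using assms(2) by induction (auto intro: set_algebraD[OF assms(1)])
qed

lemma gen_algebra_mono: "\<G> \<subseteq> \<H> \<Longrightarrow> gen_algebra \<G> \<subseteq> gen_algebra \<H>"
  by (intro gen_algebra_minimal set_algebra_gen_algebra) (auto intro: gen_base)

lemma gen_algebra_idem: "set_algebra \<A> \<Longrightarrow> gen_algebra \<A> = \<A>"
  using gen_algebra_minimal[of \<A> \<A>] by (auto intro: gen_base)

text \<open>
  Adjoining one set \<open>E\<close> to an algebra of sets needs no iteration: sets pieced together from a member
  inside \<open>E\<close> and a member outside \<open>E\<close> already form an algebra.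
\<close>

lemma gen_algebra_insert:
  assumes "set_algebra \<A>" and "K \<in> gen_algebra (insert E \<A>)"
  shows "\<exists>M\<in>\<A>. \<exists>N\<in>\<A>. K = (M \<inter> E) \<union> (N - E)"
  using assms(2)
proof induction
  case (gen_base K)
  then show ?case
  proof
    assume "K = E"
    then show ?thesis by (intro bexI[of _ UNIV] bexI[of _ "{}"]) (auto intro: set_algebraD[OF assms(1)])
  next
    assume "K \<in> \<A>"
    then show ?thesis by (intro bexI[of _ K]) auto
  qed
next
  case gen_UNIV
  show ?case by (intro bexI[of _ UNIV]) (auto intro: set_algebraD[OF assms(1)])
next
  case (gen_Compl K)
  then obtain M N where "M \<in> \<A>" "N \<in> \<A>" "K = (M \<inter> E) \<union> (N - E)" by auto
  then show ?case
    by (intro bexI[of _ "- M"] bexI[of _ "- N"]) (auto intro: set_algebraD[OF assms(1)])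
next
  case (gen_Int K L)
  then obtain M N M' N' where "M \<in> \<A>" "N \<in> \<A>" "K = (M \<inter> E) \<union> (N - E)"
    "M' \<in> \<A>" "N' \<in> \<A>" "L = (M' \<inter> E) \<union> (N' - E)" by auto
  then show ?case
    by (intro bexI[of _ "M \<inter> M'"] bexI[of _ "N \<inter> N'"]) (auto intro: set_algebraD[OF assms(1)])
qed

text \<open>
  A set generated by \<open>\<C>\<close> and \<open>D\<close> involves only finitely many members of \<open>D\<close>, hence lies in \<open>\<C>\<close> or in
  the stage that ends at the largest of them.
\<close>

lemma gen_algebra_filtration:
  fixes lt :: "'a set \<Rightarrow> 'a set \<Rightarrow> bool"
  assumes lt: "transp lt" "totalp lt" and C: "set_algebra \<C>"
    and M: "M \<in> gen_algebra (\<C> \<union> D)"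
  shows "M \<in> \<C> \<or> (\<exists>j\<in>D. M \<in> gen_algebra (insert j (\<C> \<union> {i\<in>D. lt i j})))"
  using M
proof induction
  case (gen_base M)
  then show ?case using gen_algebra.gen_base by blast
next
  case gen_UNIV
  show ?case using C set_algebraD by blast
next
  case (gen_Compl M)
  then show ?case using set_algebraD(3)[OF C] gen_algebra.gen_Compl by blast
next
  case (gen_Int M N)
  let ?G = "\<lambda>j. gen_algebra (insert j (\<C> \<union> {i\<in>D. lt i j}))"
  have C_le: "\<C> \<subseteq> ?G j" for j by (auto intro: gen_base)
  have mono: "?G j \<subseteq> ?G k" if "lt j k" "j \<in> D" for j k
    using that lt(1) by (intro gen_algebra_mono) (auto dest: transpD)
  have Int: "M \<inter> N \<in> ?G j" if "M \<in> ?G j" "N \<in> ?G j" for j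
    using that by (rule gen_algebra.gen_Int)
  show ?case
  proof (cases "M \<in> \<C> \<and> N \<in> \<C>")
    case True
    then show ?thesis using set_algebraD(4)[OF C] by blast
  next
    case False
    then obtain j k where jk: "j \<in> D" "k \<in> D" "M \<in> ?G j" "N \<in> ?G k"
      using gen_Int.IH C_le by (meson subsetD)
    consider "j = k" | "lt j k" | "lt k j"
      using lt(2) by (auto simp: totalp_on_def)
    then show ?thesis
    proof cases
      case 1 then show ?thesis using jk Int by blast
    next
      case 2 then show ?thesis using jk Int mono[of j k] by blast
    next
      case 3 then show ?thesis using jk Int mono[of k j] by blast
    qed
  qed
qed

text \<open>
  The successor step. By the shape of the sets in the enlarged algebra, its simple functions are
  \<open>g + h * ind E\<close> with \<open>g\<close>, \<open>h\<close> simple over \<open>\<A>\<close>. So \<open>h \<mapsto> h * ind E\<close> maps the old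
  simple functions onto the quotient of the new ones by the old ones and \<open>null_funs \<I>\<close>, and its
  kernel consists of those \<open>h\<close> for which \<open>h * ind E\<close> agrees with an old simple function up to \<open>\<I>\<close>. Whether this happens
  depends only on the support of \<open>h\<close>: the kernel is \<open>null_funs \<J>\<close> for another ideal of sets \<open>\<J>\<close>,
  and the quotient is thus of the kind assumed to be free.
\<close>

lemma basis_mod_adjoin_set:
  fixes \<A> :: "'a set set"
  assumes A: "set_algebra \<A>" and I: "set_ideal \<I>"
    and free: "\<And>\<J>. set_ideal \<J> \<Longrightarrow> \<exists>B. fm.basis_mod (null_funs \<J>) (simple_funs \<A>) B"
  shows "\<exists>B. fm.basis_mod (simple_funs \<A> \<union> null_funs \<I>) (simple_funs (gen_algebra (insert E \<A>))) B"
proof -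
  let ?A' = "gen_algebra (insert E \<A>)" and ?H = "simple_funs \<A> \<union> null_funs \<I>"
  note alg = set_algebraD[OF A] and idl = set_idealD[OF I]
  \<comment> \<open>A set is in \<J> if some M in \<A> covers it on which E coincides, up to \<I>, with a member N of \<A>.
    Taking N inside M makes two such pairs compatible under union.\<close>
  define \<J> where "\<J> = {K. \<exists>M\<in>\<A>. \<exists>N\<in>\<A>. K \<subseteq> M \<and> M \<inter> sym_diff E N \<in> \<I> \<and> N \<subseteq> M}"
  have J: "set_ideal \<J>"
    unfolding set_ideal_def
  proof (intro conjI ballI allI impI)
    show "{} \<in> \<J>" unfolding \<J>_def using alg(2) idl(1) by (auto intro!: bexI[of _ "{}"])
    fix K assume "K \<in> \<J>"
    then obtain M N where K: "M \<in> \<A>" "N \<in> \<A>" "K \<subseteq> M" "M \<inter> sym_diff E N \<in> \<I>" "N \<subseteq> M"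
      unfolding \<J>_def by blast
    show "L \<in> \<J>" if "L \<subseteq> K" for L using K that unfolding \<J>_def by blast
    fix L assume "L \<in> \<J>"
    then obtain M' N' where L: "M' \<in> \<A>" "N' \<in> \<A>" "L \<subseteq> M'" "M' \<inter> sym_diff E N' \<in> \<I>" "N' \<subseteq> M'"
      unfolding \<J>_def by blast
    have "(M \<union> M') \<inter> sym_diff E (N \<union> N') \<in> \<I>"
      by (rule idl(3)[OF idl(2)[OF K(4) L(4)]]) (use K(5) L(5) in auto)
    moreover have "M \<union> M' \<in> \<A>" "N \<union> N' \<in> \<A>" "K \<union> L \<subseteq> M \<union> M'" "N \<union> N' \<subseteq> M \<union> M'"
      using K L alg(5) by blast+
    ultimately show "K \<union> L \<in> \<J>" unfolding \<J>_def by blast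
  qed
  have mult_add: "(f + g) * ind E = f * ind E + g * ind E" for f g :: "'a \<Rightarrow> int"
    by (simp add: distrib_right)
  have mult_scale: "scale_fun c f * ind E = scale_fun c (f * ind E)" for c and f :: "'a \<Rightarrow> int"
    by (simp add: fun_eq_iff)
  have mult_sum: "(\<Sum>b\<in>F. scale_fun (c b) b) * ind E = (\<Sum>b\<in>F. scale_fun (c b) (b * ind E))"
    for F and c :: "('a \<Rightarrow> int) \<Rightarrow> int"
    by (simp add: sum_distrib_right mult_scale)
  have spanH: "fm.span ?H = {f + n |f n. f \<in> simple_funs \<A> \<and> n \<in> null_funs \<I>}"
    by (simp add: fm.span_Un span_simple_funs span_null_funs[OF I])
  have J_iff: "f * ind E \<in> fm.span ?H \<longleftrightarrow> f \<in> null_funs \<J>" if f: "f \<in> simple_funs \<A>" for f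
  proof
    assume "f * ind E \<in> fm.span ?H"
    then obtain g n where g: "g \<in> simple_funs \<A>" and n: "n \<in> null_funs \<I>"
      and eq: "f * ind E = g + n" using spanH by blast
    have eq': "f x * of_bool (x \<in> E) = g x + n x" for x
      using fun_cong[OF eq, of x] by simp
    \<comment> \<open>Off the support of n, a point of the support of f lies in E exactly when g is nonzero there.\<close>
    let ?M = "{x. f x \<noteq> 0}" and ?N = "{x. g x \<noteq> 0} \<inter> {x. f x \<noteq> 0}"
    have "?M \<in> \<A>" "?N \<in> \<A>" using simple_funs_support[OF A] f g alg(4) by auto
    moreover have "?M \<inter> sym_diff E ?N \<in> \<I>"
    proof (rule idl(3))
      show "{x. n x \<noteq> 0} \<in> \<I>" using n by (simp add: null_funs_def)
      show "?M \<inter> sym_diff E ?N \<subseteq> {x. n x \<noteq> 0}"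
      proof
        fix x assume "x \<in> ?M \<inter> sym_diff E ?N"
        then show "x \<in> {x. n x \<noteq> 0}" using eq'[of x] by auto
      qed
    qed
    ultimately show "f \<in> null_funs \<J>" unfolding null_funs_def \<J>_def by blast
  next
    assume "f \<in> null_funs \<J>"
    then obtain M N where MN: "M \<in> \<A>" "N \<in> \<A>" "{x. f x \<noteq> 0} \<subseteq> M" "M \<inter> sym_diff E N \<in> \<I>"
      unfolding null_funs_def \<J>_def by blast
    have "f * ind N \<in> simple_funs \<A>" using simple_funs_times_ind[OF A f MN(2)] .
    moreover have "f * ind E - f * ind N \<in> null_funs \<I>"
      unfolding null_funs_def mem_Collect_eq
    proof (rule idl(3)[OF MN(4)], rule subsetI)
      fix x assume "x \<in> {x. (f * ind E - f * ind N) x \<noteq> 0}"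
      then show "x \<in> M \<inter> sym_diff E N"
        using MN(3) by (auto simp: of_bool_def split: if_splits)
    qed
    moreover have "f * ind E = f * ind N + (f * ind E - f * ind N)" by simp
    ultimately show "f * ind E \<in> fm.span ?H" unfolding spanH by blast
  qed
  obtain B where basis: "fm.basis_mod (null_funs \<J>) (simple_funs \<A>) B" using free[OF J] ..
  note B = fm.basis_modD[OF basis]
  define B' where "B' = (\<lambda>b. b * ind E) ` B"
  have A_A': "simple_funs \<A> \<subseteq> simple_funs ?A'"
    by (intro simple_funs_mono) (auto intro: gen_base)
  have E: "E \<in> ?A'" by (simp add: gen_base)
  have "B' \<subseteq> simple_funs ?A'"
    using B(1) A_A' simple_funs_times_ind[OF set_algebra_gen_algebra _ E] by (auto simp: B'_def)
  moreover have "simple_funs ?A' \<subseteq> fm.span (?H \<union> B')"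
  proof -
    have times_E: "h * ind E \<in> fm.span (?H \<union> B')" if h: "h \<in> simple_funs \<A>" for h
    proof -
      obtain n g where n: "n \<in> null_funs \<J>" and g: "g \<in> fm.span B" and hng: "h = n + g"
        using h B(2) by (auto simp: fm.span_Un span_null_funs[OF J])
      have "g \<in> simple_funs \<A>" using g fm.span_minimal[OF B(1) subspace_simple_funs] by blast
      then have "n \<in> simple_funs \<A>"
        using h hng fm.subspace_diff[OF subspace_simple_funs, of h _ g] by simp
      then have "n * ind E \<in> fm.span (?H \<union> B')"
        using n J_iff fm.span_mono[of ?H "?H \<union> B'"] by blast
      moreover have "g * ind E \<in> fm.span (?H \<union> B')"
      proof -
        obtain F c where F: "finite F" "F \<subseteq> B" and gF: "g = (\<Sum>b\<in>F. scale_fun (c b) b)"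
          using g by (auto simp: fm.span_explicit)
        show ?thesis
          unfolding gF mult_sum using F
          by (intro fm.span_sum fm.span_scale fm.span_base) (auto simp: B'_def)
      qed
      ultimately show ?thesis by (simp add: hng mult_add fm.span_add)
    qed
    have "ind K \<in> fm.span (?H \<union> B')" if "K \<in> ?A'" for K
    proof -
      obtain M N where MN: "M \<in> \<A>" "N \<in> \<A>" "K = (M \<inter> E) \<union> (N - E)"
        using gen_algebra_insert[OF A \<open>K \<in> ?A'\<close>] by blast
      have "ind K = ind N + (ind M - ind N) * ind E"
        unfolding MN(3) by (auto simp: fun_eq_iff of_bool_def)
      moreover have "ind N \<in> fm.span (?H \<union> B')"
        using MN by (auto intro: fm.span_base ind_simple_funs)
      moreover have "(ind M - ind N) * ind E \<in> fm.span (?H \<union> B')"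
        using MN by (intro times_E fm.subspace_diff subspace_simple_funs ind_simple_funs)
      ultimately show ?thesis by (simp add: fm.span_add)
    qed
    then have "ind ` ?A' \<subseteq> fm.span (?H \<union> B')" by blast
    then show ?thesis unfolding simple_funs_def[of ?A'] by (rule fm.span_minimal) simp
  qed
  moreover have "\<forall>b\<in>F. c b = 0"
    if F: "finite F" "F \<subseteq> B'" and S: "(\<Sum>b\<in>F. scale_fun (c b) b) \<in> fm.span ?H" for F c
  proof -
    obtain F0 where F0: "F0 \<subseteq> B" "inj_on (\<lambda>b. b * ind E) F0" "F = (\<lambda>b. b * ind E) ` F0"
      using F(2) unfolding B'_def subset_image_inj by blast
    have fin: "finite F0" using F(1) F0 finite_imageD by blast
    let ?a = "\<Sum>b\<in>F0. scale_fun (c (b * ind E)) b"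
    have "?a * ind E = (\<Sum>b\<in>F. scale_fun (c b) b)"
      unfolding F0(3) sum.reindex[OF F0(2)] by (simp add: sum_distrib_right mult_scale)
    moreover have "?a \<in> simple_funs \<A>"
      using F0(1) B(1) by (intro fm.subspace_sum fm.subspace_scale subspace_simple_funs) auto
    ultimately have "?a \<in> fm.span (null_funs \<J>)"
      using S J_iff[of ?a] by (simp add: fm.span_base)
    then have "\<forall>b\<in>F0. c (b * ind E) = 0"
      using B(3)[OF fin F0(1), of "\<lambda>b. c (b * ind E)"] by blast
    then show ?thesis using F0(3) by blast
  qed
  ultimately show ?thesis unfolding fm.basis_mod_def by blast
qed

section \<open>Freeness by transfinite adjunction of sets\<close>

text \<open>
  Starting from \<open>\<C>\<close>, the sets in \<open>D\<close> are adjoined one at a time along a well-order. The step at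
  \<open>j\<close> is free by the adjunction of a single set provided the algebra built before \<open>j\<close> has free
  quotients modulo all ideals. The ideal must be arbitrary in that hypothesis, because
  the step replaces \<open>\<I>\<close> by an ideal that depends on \<open>j\<close>.
\<close>

lemma basis_mod_generate:
  fixes lt :: "'a set \<Rightarrow> 'a set \<Rightarrow> bool"
  assumes wf: "wfp lt" and trans: "transp lt" and total: "totalp lt"
    and C: "set_algebra \<C>" and I: "set_ideal \<I>"
    and free: "\<And>j \<J>. j \<in> D \<Longrightarrow> set_ideal \<J> \<Longrightarrow>
      \<exists>B. fm.basis_mod (null_funs \<J>) (simple_funs (gen_algebra (\<C> \<union> {i\<in>D. lt i j}))) B"
  shows "\<exists>B. fm.basis_mod (simple_funs \<C> \<union> null_funs \<I>) (simple_funs (gen_algebra (\<C> \<union> D))) B"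
proof -
  let ?H = "simple_funs \<C> \<union> null_funs \<I>"
  define below where "below j = gen_algebra (\<C> \<union> {i\<in>D. lt i j})" for j
  define upto where "upto j = gen_algebra (insert j (below j))" for j
  have C_below: "\<C> \<subseteq> below j" for j by (auto simp: below_def intro: gen_base)
  have alg: "set_algebra (below j)" "set_algebra (upto j)" for j
    by (simp_all add: below_def upto_def set_algebra_gen_algebra)
  have upto_below: "upto j \<subseteq> below i" if "j \<in> D" "lt j i" for i j
  proof -
    have "below j \<subseteq> below i"
      unfolding below_def using that trans by (intro gen_algebra_mono) (auto dest: transpD)
    moreover have "j \<in> below i" using that by (auto simp: below_def intro: gen_base)
    ultimately show ?thesis unfolding upto_def by (intro gen_algebra_minimal alg) auto
  qed
  have upto_D: "upto j \<subseteq> gen_algebra (\<C> \<union> D)" if "j \<in> D" for j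
  proof -
    have "below j \<subseteq> gen_algebra (\<C> \<union> D)"
      unfolding below_def by (intro gen_algebra_mono) auto
    then show ?thesis
      unfolding upto_def using that
      by (intro gen_algebra_minimal set_algebra_gen_algebra) (auto intro: gen_base)
  qed
  have cover: "simple_funs (gen_algebra (\<C> \<union> S)) \<subseteq> fm.span (?H \<union> (\<Union>j\<in>S. simple_funs (upto j)))"
    if "S \<subseteq> D" for S
  proof -
    have "ind M \<in> ?H \<union> (\<Union>j\<in>S. simple_funs (upto j))" if M: "M \<in> gen_algebra (\<C> \<union> S)" for M
      using gen_algebra_filtration[OF trans total C M]
    proof
      assume "M \<in> \<C>"
      then show ?thesis using ind_simple_funs by blast
    next
      assume "\<exists>j\<in>S. M \<in> gen_algebra (insert j (\<C> \<union> {i\<in>S. lt i j}))"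
      then obtain j where j: "j \<in> S" "M \<in> gen_algebra (insert j (\<C> \<union> {i\<in>S. lt i j}))" by blast
      have "insert j (\<C> \<union> {i\<in>S. lt i j}) \<subseteq> insert j (below j)"
        using \<open>S \<subseteq> D\<close> by (auto simp: below_def intro: gen_base)
      then have "M \<in> upto j" unfolding upto_def using j(2) gen_algebra_mono by blast
      then show ?thesis using j(1) ind_simple_funs by blast
    qed
    then have "ind ` gen_algebra (\<C> \<union> S) \<subseteq> fm.span (?H \<union> (\<Union>j\<in>S. simple_funs (upto j)))"
      using fm.span_superset by blast
    then show ?thesis
      unfolding simple_funs_def[of "gen_algebra (\<C> \<union> S)"] by (rule fm.span_minimal) simp
  qed
  have "\<exists>B. fm.basis_mod (simple_funs (below j) \<union> null_funs \<I>) (simple_funs (upto j)) B"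
    if "j \<in> D" for j
    unfolding upto_def using free[OF that] by (intro basis_mod_adjoin_set alg I) (simp add: below_def)
  then obtain B where B: "\<And>j. j \<in> D \<Longrightarrow>
      fm.basis_mod (simple_funs (below j) \<union> null_funs \<I>) (simple_funs (upto j)) (B j)"
    by metis
  have "fm.basis_mod ?H (simple_funs (gen_algebra (\<C> \<union> D))) (\<Union>j\<in>D. B j)"
  proof (rule fm.basis_mod_chain[OF wf trans total B])
    show "?H \<subseteq> fm.span (simple_funs (below i) \<union> null_funs \<I>)" for i
      using simple_funs_mono[OF C_below] fm.span_superset[of "simple_funs (below i) \<union> null_funs \<I>"]
      by blast
    show "simple_funs (upto j) \<subseteq> fm.span (simple_funs (below i) \<union> null_funs \<I>)"
      if "j \<in> D" "lt j i" for i j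
      using simple_funs_mono[OF upto_below[OF that]]
        fm.span_superset[of "simple_funs (below i) \<union> null_funs \<I>"] by blast
    show "simple_funs (below i) \<union> null_funs \<I>
        \<subseteq> fm.span (?H \<union> (\<Union>j\<in>{j\<in>D. lt j i}. simple_funs (upto j)))" for i
    proof -
      have "simple_funs (below i) \<subseteq> fm.span (?H \<union> (\<Union>j\<in>{j\<in>D. lt j i}. simple_funs (upto j)))"
        unfolding below_def by (rule cover) auto
      then show ?thesis
        using fm.span_superset[of "?H \<union> (\<Union>j\<in>{j\<in>D. lt j i}. simple_funs (upto j))"] by blast
    qed
    show "simple_funs (gen_algebra (\<C> \<union> D)) \<subseteq> fm.span (?H \<union> (\<Union>j\<in>D. simple_funs (upto j)))"
      by (rule cover) simp
    show "simple_funs (upto j) \<subseteq> simple_funs (gen_algebra (\<C> \<union> D))" if "j \<in> D" for j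
      using simple_funs_mono[OF upto_D[OF that]] .
  qed
  then show ?thesis ..
qed

lemma ex_strict_well_order:
  obtains lt :: "'b \<Rightarrow> 'b \<Rightarrow> bool" where "wfp lt" "transp lt" "totalp lt"
proof -
  obtain r :: "'b rel" where r: "Well_order r" "Field r = UNIV"
    using well_ordering[where 'a = 'b] by (elim exE conjE)
  let ?lt = "\<lambda>x y. (x, y) \<in> r - Id"
  have "wf (r - Id)" "trans (r - Id)" "total (r - Id)"
    using r trans_diff_Id
    by (auto simp: well_order_on_def linear_order_on_def partial_order_on_def preorder_on_def)
  then have "wfp ?lt" "transp ?lt" "totalp ?lt"
    by (simp_all only: wfp_wf_eq transp_trans_eq totalp_on_total_on_eq)
  then show thesis by (rule that)
qed

text \<open>
  The bottom of the chain in the absolute case: the constants modulo an ideal are \<open>0\<close> or \<open>\<int>\<close>,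
  according to whether the whole space is negligible.
\<close>

lemma basis_mod_constants:
  fixes \<I> :: "'a set set"
  assumes I: "set_ideal \<I>"
  shows "\<exists>B. fm.basis_mod (null_funs \<I>) (simple_funs {{}, UNIV}) B"
proof (cases "UNIV \<in> \<I>")
  case True
  then have "null_funs \<I> = UNIV"
    using set_idealD(3)[OF I] by (auto simp: null_funs_def)
  then have "fm.basis_mod (null_funs \<I>) (simple_funs {{}, UNIV}) {}"
    by (simp add: fm.basis_mod_def)
  then show ?thesis ..
next
  case False
  let ?e = "ind UNIV :: 'a \<Rightarrow> int"
  have "?e \<in> simple_funs {{}, UNIV}" by (intro ind_simple_funs) simp
  moreover have "simple_funs {{}, UNIV} \<subseteq> fm.span (null_funs \<I> \<union> {?e})"
  proof -
    have "ind {} = (0 :: 'a \<Rightarrow> int)" by (simp add: fun_eq_iff)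
    then have "ind ` {{}, UNIV} \<subseteq> fm.span (null_funs \<I> \<union> {?e})"
      by (auto intro: fm.span_zero fm.span_base)
    then show ?thesis unfolding simple_funs_def by (rule fm.span_minimal) simp
  qed
  moreover have "\<forall>b\<in>F. c b = 0"
    if "F \<subseteq> {?e}" "(\<Sum>b\<in>F. scale_fun (c b) b) \<in> fm.span (null_funs \<I>)" for F c
  proof (cases "F = {}")
    case False
    then have F: "F = {?e}" using that(1) by blast
    then have "scale_fun (c ?e) ?e \<in> null_funs \<I>"
      using that(2) span_null_funs[OF I] by auto
    then have "{x :: 'a. c ?e \<noteq> 0} \<in> \<I>"
      by (simp add: null_funs_def)
    then show ?thesis using \<open>UNIV \<notin> \<I>\<close> F by (cases "c ?e = 0") auto
  qed simp
  ultimately have "fm.basis_mod (null_funs \<I>) (simple_funs {{}, UNIV}) {?e}"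
    by (simp add: fm.basis_mod_def)
  then show ?thesis ..
qed

text \<open>
  The absolute theorem. Well-order \<open>\<A>\<close> itself; by induction along this order the algebra generated by
  each initial segment has free quotients modulo every ideal, since the hypothesis of the
  generation lemma for a segment speaks only of smaller segments.
\<close>

lemma basis_mod_null_funs:
  fixes \<A> :: "'a set set"
  assumes A: "set_algebra \<A>" and I: "set_ideal \<I>"
  shows "\<exists>B. fm.basis_mod (null_funs \<I>) (simple_funs \<A>) B"
proof -
  obtain lt :: "'a set \<Rightarrow> 'a set \<Rightarrow> bool" where lt: "wfp lt" "transp lt" "totalp lt"
    by (rule ex_strict_well_order)
  define free where "free S \<longleftrightarrow> (\<forall>\<J>. set_ideal \<J> \<longrightarrow>
      (\<exists>B. fm.basis_mod (null_funs \<J>) (simple_funs (gen_algebra S)) B))" for S :: "'a set set"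
  let ?C = "{{}, UNIV} :: 'a set set"
  have C: "set_algebra ?C" by (auto simp: set_algebra_def)
  have gen_C: "gen_algebra (?C \<union> S) = gen_algebra S" for S
  proof
    have "S \<subseteq> gen_algebra S" by (auto intro: gen_base)
    then show "gen_algebra (?C \<union> S) \<subseteq> gen_algebra S"
      using set_algebraD(1,2)[OF set_algebra_gen_algebra]
      by (intro gen_algebra_minimal set_algebra_gen_algebra) auto
  qed (intro gen_algebra_mono, auto)
  have step: "free S" if "\<And>j. j \<in> S \<Longrightarrow> free {i\<in>S. lt i j}" for S
    unfolding free_def
  proof (intro allI impI)
    fix \<J> :: "'a set set" assume J: "set_ideal \<J>"
    have "\<exists>B. fm.basis_mod (simple_funs ?C \<union> null_funs \<J>) (simple_funs (gen_algebra (?C \<union> S))) B"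
    proof (rule basis_mod_generate[OF lt C J])
      fix j and \<J>' :: "'a set set" assume "j \<in> S" "set_ideal \<J>'"
      then show "\<exists>B. fm.basis_mod (null_funs \<J>') (simple_funs (gen_algebra (?C \<union> {i\<in>S. lt i j}))) B"
        using that[of j] unfolding free_def gen_C by blast
    qed
    then obtain B2 where "fm.basis_mod (simple_funs ?C \<union> null_funs \<J>) (simple_funs (gen_algebra S)) B2"
      unfolding gen_C by blast
    moreover obtain B1 where "fm.basis_mod (null_funs \<J>) (simple_funs ?C) B1"
      using basis_mod_constants[OF J] by blast
    moreover have "simple_funs ?C \<subseteq> simple_funs (gen_algebra S)"
      using set_algebraD(1,2)[OF set_algebra_gen_algebra] by (intro simple_funs_mono) auto
    ultimately have "fm.basis_mod (null_funs \<J>) (simple_funs (gen_algebra S)) (B1 \<union> B2)"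
      by (intro fm.basis_mod_trans)
    then show "\<exists>B. fm.basis_mod (null_funs \<J>) (simple_funs (gen_algebra S)) B" ..
  qed
  have initial: "free {i\<in>\<A>. lt i j}" for j
  proof (induction j rule: wfp_induct_rule[OF lt(1)])
    case (1 j)
    show ?case
    proof (rule step)
      fix k assume "k \<in> {i\<in>\<A>. lt i j}"
      moreover from this have "{i \<in> {i\<in>\<A>. lt i j}. lt i k} = {i\<in>\<A>. lt i k}"
        using lt(2) by (auto dest: transpD)
      ultimately show "free {i \<in> {i\<in>\<A>. lt i j}. lt i k}" using 1 by simp
    qed
  qed
  have "free \<A>" by (rule step) (rule initial)
  then show ?thesis using I by (simp add: free_def gen_algebra_idem[OF A])
qed

text \<open>
  The relative theorem. The stages are algebras again, so the absolute theorem
  supplies the hypothesis of the generation lemma at every step.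
\<close>

lemma basis_mod_subalgebra:
  fixes \<A> \<C> :: "'a set set"
  assumes A: "set_algebra \<A>" and C: "set_algebra \<C>" "\<C> \<subseteq> \<A>" and I: "set_ideal \<I>"
  shows "\<exists>B. fm.basis_mod (simple_funs \<C> \<union> null_funs \<I>) (simple_funs \<A>) B"
proof -
  obtain lt :: "'a set \<Rightarrow> 'a set \<Rightarrow> bool" where lt: "wfp lt" "transp lt" "totalp lt"
    by (rule ex_strict_well_order)
  have "\<exists>B. fm.basis_mod (simple_funs \<C> \<union> null_funs \<I>) (simple_funs (gen_algebra (\<C> \<union> \<A>))) B"
    by (rule basis_mod_generate[OF lt C(1) I basis_mod_null_funs[OF set_algebra_gen_algebra]])
  moreover have "gen_algebra (\<C> \<union> \<A>) = \<A>"
    using C(2) gen_algebra_idem[OF A] by (simp only: Un_absorb1)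
  ultimately show ?thesis by (simp only:)
qed

section \<open>Bounded functions on a topological space\<close>

text \<open>
  Sets of points of the whole type that miss a dense open subset of \<open>X\<close>. The
  complement of \<open>topspace X\<close> belongs to this ideal, so values off the space do not count and total
  functions can stand in for functions on the space.
\<close>

definition nowhere_dense_sets :: "'a topology \<Rightarrow> 'a set set" where
  "nowhere_dense_sets X = {K. \<exists>U. openin X U \<and> X closure_of U = topspace X \<and> K \<inter> U = {}}"

lemma set_ideal_nowhere_dense_sets: "set_ideal (nowhere_dense_sets X)"
  unfolding set_ideal_def
proof (intro conjI ballI allI impI)
  show "{} \<in> nowhere_dense_sets X"
    by (auto simp: nowhere_dense_sets_def intro!: exI[of _ "topspace X"])
  fix K assume "K \<in> nowhere_dense_sets X"
  then obtain U where U: "openin X U" "X closure_of U = topspace X" "K \<inter> U = {}"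
    by (auto simp: nowhere_dense_sets_def)
  then show "L \<in> nowhere_dense_sets X" if "L \<subseteq> K" for L
    using that by (auto simp: nowhere_dense_sets_def)
  fix L assume "L \<in> nowhere_dense_sets X"
  then obtain V where V: "openin X V" "X closure_of V = topspace X" "L \<inter> V = {}"
    by (auto simp: nowhere_dense_sets_def)
  have "X closure_of (U \<inter> V) = topspace X" "openin X (U \<inter> V)"
    using dense_openin_Int[OF U(1,2) V(2)] openin_Int[OF U(1) V(1)] .
  moreover have "(K \<union> L) \<inter> (U \<inter> V) = {}" using U V by blast
  ultimately show "K \<union> L \<in> nowhere_dense_sets X"
    unfolding nowhere_dense_sets_def by blast
qed

lemma set_algebra_UNIV: "set_algebra UNIV"
  by (simp add: set_algebra_def)

lemma restrict_simple_funs: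
  "(\<lambda>f. restrict f (topspace X)) ` simple_funs UNIV = carrier (bounded_fun_group X)"
proof (intro equalityI subsetI)
  fix g assume "g \<in> (\<lambda>f. restrict f (topspace X)) ` simple_funs UNIV"
  then obtain f :: "'a \<Rightarrow> int" where f: "finite (range f)" "g = restrict f (topspace X)"
    using simple_funs_iff[OF set_algebra_UNIV] by blast
  then have "\<bar>f x\<bar> \<le> Max (range (\<lambda>x. \<bar>f x\<bar>))" for x
    by (intro Max_ge) (auto simp: image_image[of abs f, symmetric])
  then show "g \<in> carrier (bounded_fun_group X)"
    using f(2) by (auto simp: carrier_bounded_fun_group)
next
  fix g assume "g \<in> carrier (bounded_fun_group X)"
  then obtain M where ext: "g \<in> extensional (topspace X)" and M: "\<And>x. x \<in> topspace X \<Longrightarrow> \<bar>g x\<bar> \<le> M"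
    by (auto simp: carrier_bounded_fun_group)
  have "range g \<subseteq> insert undefined {-M..M}"
  proof
    fix y assume "y \<in> range g"
    then obtain x where "y = g x" by blast
    then show "y \<in> insert undefined {-M..M}"
      using M[of x] ext by (cases "x \<in> topspace X") (auto simp: extensional_def)
  qed
  then have "g \<in> simple_funs UNIV"
    using simple_funs_iff[OF set_algebra_UNIV] finite_subset by blast
  then show "g \<in> (\<lambda>f. restrict f (topspace X)) ` simple_funs UNIV"
    using extensional_restrict[OF ext] by (metis imageI)
qed

text \<open>
  An extensional function takes one extra value off the space, which leaves its range finite.
\<close>

lemma carrier_bounded_fun_group_subset: "carrier (bounded_fun_group X) \<subseteq> simple_funs UNIV"
proof
  fix g assume g: "g \<in> carrier (bounded_fun_group X)"
  then obtain f :: "'a \<Rightarrow> int" where "f \<in> simple_funs UNIV" "g = restrict f (topspace X)"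
    using restrict_simple_funs by blast
  moreover have "range (restrict f (topspace X)) \<subseteq> insert undefined (range f)"
    by (auto simp: restrict_def)
  ultimately show "g \<in> simple_funs UNIV"
    using simple_funs_iff[OF set_algebra_UNIV] finite_subset by blast
qed

lemma restrict_mem_bounded_residual_funs:
  assumes "f \<in> simple_funs UNIV"
  shows "restrict f (topspace X) \<in> bounded_residual_funs X \<longleftrightarrow> f \<in> null_funs (nowhere_dense_sets X)"
proof -
  have "restrict f (topspace X) \<in> carrier (bounded_fun_group X)"
    using assms restrict_simple_funs by blast
  moreover have "residual_fun X (restrict f (topspace X)) \<longleftrightarrow> f \<in> null_funs (nowhere_dense_sets X)"
  proof -
    have "U \<subseteq> {x \<in> topspace X. restrict f (topspace X) x = 0} \<longleftrightarrow> {x. f x \<noteq> 0} \<inter> U = {}"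
      if "openin X U" for U
      using openin_subset[OF that] by auto
    then show ?thesis
      unfolding residual_fun_def null_funs_def nowhere_dense_sets_def by blast
  qed
  ultimately show ?thesis by (simp add: bounded_residual_funs_def)
qed

text \<open>
  The algebra that turns continuity of integer-valued functions into a condition on level sets.
\<close>

definition clopen_traces :: "'a topology \<Rightarrow> 'a set set" where
  "clopen_traces X = {M. openin X (topspace X \<inter> M) \<and> openin X (topspace X - M)}"

lemma set_algebra_clopen_traces: "set_algebra (clopen_traces X)"
  unfolding set_algebra_def
proof (intro conjI ballI)
  show "UNIV \<in> clopen_traces X" by (simp add: clopen_traces_def)
  fix M assume M: "M \<in> clopen_traces X"
  then show "- M \<in> clopen_traces X" by (simp add: clopen_traces_def Diff_eq)
  fix N assume N: "N \<in> clopen_traces X"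
  have "topspace X \<inter> (M \<inter> N) = (topspace X \<inter> M) \<inter> (topspace X \<inter> N)"
    "topspace X - M \<inter> N = (topspace X - M) \<union> (topspace X - N)" by auto
  then show "M \<inter> N \<in> clopen_traces X"
    using M N by (simp add: clopen_traces_def openin_Int openin_Un)
qed

lemma restrict_mem_bounded_cont_funs:
  assumes f: "f \<in> simple_funs UNIV"
  shows "restrict f (topspace X) \<in> bounded_cont_funs X \<longleftrightarrow>
    (\<forall>k. f -` {k} \<in> clopen_traces X)"
proof -
  let ?D = "discrete_topology (UNIV :: int set)"
  have "restrict f (topspace X) \<in> carrier (bounded_fun_group X)"
    using assms restrict_simple_funs by blast
  then have "restrict f (topspace X) \<in> bounded_cont_funs X \<longleftrightarrow>
      continuous_map X ?D (restrict f (topspace X))"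
    by (simp add: bounded_cont_funs_def)
  also have "\<dots> \<longleftrightarrow> (\<forall>U. openin X {x \<in> topspace X. f x \<in> U})"
    by (simp add: continuous_map_def cong: conj_cong)
  also have "\<dots> \<longleftrightarrow> (\<forall>k. f -` {k} \<in> clopen_traces X)"
  proof safe
    fix k assume *: "\<forall>U. openin X {x \<in> topspace X. f x \<in> U}"
    have "topspace X \<inter> f -` {k} = {x \<in> topspace X. f x \<in> {k}}"
      "topspace X - f -` {k} = {x \<in> topspace X. f x \<in> - {k}}" by auto
    then show "f -` {k} \<in> clopen_traces X" using spec[OF *, of "{k}"] spec[OF *, of "- {k}"]
      unfolding clopen_traces_def by simp
  next
    fix U assume *: "\<forall>k. f -` {k} \<in> clopen_traces X"
    have "{x \<in> topspace X. f x \<in> U} = (\<Union>k\<in>U. topspace X \<inter> f -` {k})" by auto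
    moreover have "openin X (\<Union>k\<in>U. topspace X \<inter> f -` {k})"
      using * by (intro openin_Union) (auto simp: clopen_traces_def)
    ultimately show "openin X {x \<in> topspace X. f x \<in> U}" by (simp only:)
  qed
  finally show ?thesis .
qed

text \<open>
  Restriction to \<open>topspace X\<close> presents the bounded functions as an image of the simple functions
  over the algebra of all sets, so a quotient can be computed in additive notation.
\<close>

lemma free_abelian_bounded_fun_group_Mod:
  assumes N: "subgroup N (bounded_fun_group X)"
    and kernel: "\<And>f. f \<in> simple_funs UNIV \<Longrightarrow> restrict f (topspace X) \<in> N \<longleftrightarrow> f \<in> fm.span H"
    and basis: "fm.basis_mod H (simple_funs UNIV) B"
  shows "free_abelian (bounded_fun_group X Mod N)"
proof -
  let ?G = "bounded_fun_group X" and ?r = "\<lambda>f. restrict f (topspace X)"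
  interpret G: comm_group ?G by (rule comm_group_bounded_fun_group)
  interpret N: normal N ?G using N by (rule G.subgroup_imp_normal)
  have in_G: "?r f \<in> carrier ?G" if "f \<in> simple_funs UNIV" for f
    using that restrict_simple_funs by blast
  show ?thesis
  proof (rule free_abelian_of_basis_mod[OF fm.relative_module_axioms _ subspace_simple_funs _ _ _ basis,
        where \<phi> = "\<lambda>f. N #>\<^bsub>?G\<^esub> ?r f"])
    show "comm_group (?G Mod N)" using N by (rule G.abelian_FactGroup)
    show "(\<lambda>f. N #>\<^bsub>?G\<^esub> ?r f) ` simple_funs UNIV = carrier (?G Mod N)"
      unfolding carrier_FactGroup restrict_simple_funs[symmetric] image_image ..
    show "N #>\<^bsub>?G\<^esub> ?r (f + g) = (N #>\<^bsub>?G\<^esub> ?r f) \<otimes>\<^bsub>?G Mod N\<^esub> (N #>\<^bsub>?G\<^esub> ?r g)"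
      if "f \<in> simple_funs UNIV" "g \<in> simple_funs UNIV" for f g
    proof -
      have "?r (f + g) = ?r f \<otimes>\<^bsub>?G\<^esub> ?r g"
        by (auto simp: mult_bounded_fun_group)
      then show ?thesis using that in_G by (simp add: N.rcos_sum)
    qed
    show "N #>\<^bsub>?G\<^esub> ?r f = \<one>\<^bsub>?G Mod N\<^esub> \<longleftrightarrow> f \<in> fm.span H" if "f \<in> simple_funs UNIV" for f
      using kernel[OF that] in_G[OF that] N G.coset_join1 G.coset_join2
      by (metis one_FactGroup G.rcos_self)
  qed
qed

theorem theorem3p5:
  fixes X :: "'a topology"
  shows "free_abelian (bounded_fun_group X Mod bounded_residual_funs X) \<and>
         free_abelian (bounded_fun_group X Mod
           (bounded_residual_funs X <#>\<^bsub>bounded_fun_group X\<^esub> bounded_cont_funs X))"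
proof
  let ?G = "bounded_fun_group X" and ?r = "\<lambda>f. restrict f (topspace X)"
  let ?R = "bounded_residual_funs X" and ?C = "bounded_cont_funs X"
  let ?I = "nowhere_dense_sets X" and ?A = "clopen_traces X"
  interpret G: comm_group ?G by (rule comm_group_bounded_fun_group)
  note I = set_ideal_nowhere_dense_sets[of X] and A = set_algebra_clopen_traces[of X]
  note simple_UNIV = simple_funs_iff[OF set_algebra_UNIV]
  obtain B where "fm.basis_mod (null_funs ?I) (simple_funs UNIV) B"
    using basis_mod_null_funs[OF set_algebra_UNIV I] by blast
  then show "free_abelian (?G Mod ?R)"
    by (rule free_abelian_bounded_fun_group_Mod[OF subgroup_bounded_residual_funs, rotated])
      (simp only: restrict_mem_bounded_residual_funs span_null_funs[OF I])
  have cont_iff: "?r f \<in> ?C \<longleftrightarrow> f \<in> simple_funs ?A" if "f \<in> simple_funs UNIV" for f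
    using restrict_mem_bounded_cont_funs[OF that] simple_funs_iff[OF A] simple_UNIV that by blast
  \<comment> \<open>Splitting f into a continuous and a residual part is the same as splitting it into a simple
    function over the algebra of sets with clopen trace and a function supported in the ideal.\<close>
  have kernel: "?r f \<in> ?R <#>\<^bsub>?G\<^esub> ?C \<longleftrightarrow> f \<in> fm.span (simple_funs ?A \<union> null_funs ?I)"
    if f: "f \<in> simple_funs UNIV" for f
  proof
    assume "?r f \<in> ?R <#>\<^bsub>?G\<^esub> ?C"
    then obtain r c where r: "r \<in> ?R" and c: "c \<in> ?C" and eq: "?r f = r \<otimes>\<^bsub>?G\<^esub> c"
      by (auto simp: set_mult_def)
    have car: "r \<in> carrier ?G" "c \<in> carrier ?G"
      using r c by (auto simp: bounded_residual_funs_def bounded_cont_funs_def)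
    then have ext: "?r r = r" "?r c = c"
      by (auto simp: carrier_bounded_fun_group extensional_restrict)
    have c': "c \<in> simple_funs UNIV" using car carrier_bounded_fun_group_subset by blast
    have "?r (f - c) = r"
    proof -
      have "f x - c x = r x" if "x \<in> topspace X" for x
        using fun_cong[OF eq, of x] that by (simp add: mult_bounded_fun_group)
      then have "?r (f - c) = ?r r" by (auto simp: restrict_def)
      then show ?thesis using ext by simp
    qed
    then have "f - c \<in> null_funs ?I"
      using restrict_mem_bounded_residual_funs[of "f - c" X] r
        fm.subspace_diff[OF subspace_simple_funs f c'] by simp
    moreover have "c \<in> simple_funs ?A" using cont_iff[OF c'] ext c by simp
    ultimately have "c + (f - c) \<in> fm.span (simple_funs ?A \<union> null_funs ?I)"
      by (intro fm.span_add) (auto intro: fm.span_base)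
    then show "f \<in> fm.span (simple_funs ?A \<union> null_funs ?I)" by simp
  next
    assume "f \<in> fm.span (simple_funs ?A \<union> null_funs ?I)"
    then obtain g n where g: "g \<in> simple_funs ?A" and n: "n \<in> null_funs ?I" and fgn: "f = g + n"
      by (auto simp: fm.span_Un span_simple_funs span_null_funs[OF I])
    have g': "g \<in> simple_funs UNIV" using g simple_funs_mono[of ?A UNIV] by blast
    then have n': "n \<in> simple_funs UNIV"
      using fm.subspace_diff[OF subspace_simple_funs f g'] fgn by simp
    have "?r f = ?r n \<otimes>\<^bsub>?G\<^esub> ?r g"
      by (auto simp: fgn mult_bounded_fun_group)
    moreover have "?r n \<in> ?R" using restrict_mem_bounded_residual_funs[OF n'] n by simp
    moreover have "?r g \<in> ?C" using cont_iff[OF g'] g by simp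
    ultimately show "?r f \<in> ?R <#>\<^bsub>?G\<^esub> ?C" by (auto simp: set_mult_def)
  qed
  obtain B' where "fm.basis_mod (simple_funs ?A \<union> null_funs ?I) (simple_funs UNIV) B'"
    using basis_mod_subalgebra[OF set_algebra_UNIV A _ I] by blast
  then show "free_abelian (?G Mod (?R <#>\<^bsub>?G\<^esub> ?C))"
    by (rule free_abelian_bounded_fun_group_Mod[OF G.mult_subgroups[OF
          subgroup_bounded_residual_funs subgroup_bounded_cont_funs] kernel, rotated])
qed

end
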